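(* Let $\mathscr M$ be a $2$-category which is a base of enrichment or a special Quillen algebra. Let $\mathcal C$ and $\mathcal D$ be small categories, let $F:(\mathbb S_{\mathcal C})^{2\text{-op}}\to\mathscr M$ and $G:(\mathbb S_{\mathcal D})^{2\text{-op}}\to\mathscr M$ be two $\mathbb S$-diagrams in $\mathscr M$, and let $(\Sigma,\sigma):F\to G$ be a level-wise weak equivalence. Then: (1) If $G$ is a Co-Segal $\mathbb S$-diagram then so is $F$. (2) If $F$ is a Co-Segal $\mathbb S$-diagram and if $\Sigma:\mathcal C\to\mathcal D$ is surjective on objects and full, then $G$ is also a Co-Segal $\mathbb S$-diagram.
   Context: Base of enrichment: a $2$-category (bicategory) $\mathscr M$ with a class $\mathscr W$ of $2$-morphisms (weak equivalences) containing all invertible $2$-morphisms, satisfying the 2-out-of-3 property for vertical composition, and stable under horizontal composition. Special Quillen algebra (for a $2$-category $\mathscr M$): each hom-category $\mathscr M(U,V)$ is a (complete and cocomplete) model category, horizontal composition preserves colimits in each variable, and horizontal composites of (trivial) cofibrations with cofibrant domains are (trivial) cofibrations; weak equivalences are those of the model categories $\mathscr M(U,V)$. For a small category $\mathcal C$, $\mathbb S_{\mathcal C}$ is the strict semi-$2$-category (no identity $1$-morphisms) with the objects of $\mathcal C$; objects of $\mathbb S_{\mathcal C}(A,B)$ are chains $s=(s_0,\dots,s_{n-1})$, $n\ge1$, of composable morphisms of $\mathcal C$ from $A$ to $B$; a morphism $s\to t$, $t=(t_0,\dots,t_{m-1})$, is a surjective nondecreasing map $f:\{0,\dots,n-1\}\to\{0,\dots,m-1\}$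 such that each $t_j$ is the composite of the $s_i$ with $i\in f^{-1}(j)$. Horizontal composition is concatenation of chains and ordinal sum of maps. A functor $\Sigma:\mathcal C\to\mathcal D$ induces a strict morphism $\mathbb S_\Sigma:\mathbb S_{\mathcal C}\to\mathbb S_{\mathcal D}$ by applying $\Sigma$ to chains. $(\cdot)^{2\text{-op}}$ reverses $2$-morphisms only. An $\mathbb S$-diagram of $\mathscr M$ is a lax morphism $F:(\mathbb S_{\mathcal C})^{2\text{-op}}\to\mathscr M$ of semi-bicategories: a function on objects, functors $F_{AB}:\mathbb S_{\mathcal C}(A,B)^{op}\to\mathscr M(FA,FB)$ and natural associative laxity maps $\varphi_{s,t}:F(s)\otimes F(t)\to F(s\otimes t)$. It is Co-Segal if $F_{AB}(u)$ is a weak equivalence for every morphism $u$ of every $\mathbb S_{\mathcal C}(A,B)$. A morphism $(\Sigma,\sigma):F\to G$ from an $\mathbb S_{\mathcal C}$-diagram to an $\mathbb S_{\mathcal D}$-diagram consists of a functor $\Sigma:\mathcal C\to\mathcal D$ with $FA=G(\Sigma A)$ for all $A$, and natural transformations $\sigma:F_{AB}\to (G\circ\mathbb S_\Sigma)_{AB}$ commuting with the laxity maps. It is a level-wise weak equivalence if all components $\sigma_t$ are weak equivalences. *)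

theory Defs
  imports Main
begin

record ('o, 'a) cat =
  Obj :: "'o set"
  Arr :: "'a set"
  Dom :: "'a \<Rightarrow> 'o"
  Cod :: "'a \<Rightarrow> 'o"
  Idt :: "'o \<Rightarrow> 'a"
  Comp :: "'a \<Rightarrow> 'a \<Rightarrow> 'a" (infixl "\<circ>\<index>" 65)

definition hom :: "('o, 'a) cat \<Rightarrow> 'o \<Rightarrow> 'o \<Rightarrow> 'a set" where
  "hom C A B = {f \<in> Arr C. Dom C f = A \<and> Cod C f = B}"

locale category =
  fixes C :: "('o, 'a) cat" (structure)
  assumes Dom_Obj: "f \<in> Arr C \<Longrightarrow> Dom C f \<in> Obj C"
    and Cod_Obj: "f \<in> Arr C \<Longrightarrow> Cod C f \<in> Obj C"
    and Idt_hom: "A \<in> Obj C \<Longrightarrow> Idt C A \<in> hom C A A"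
    and Comp_hom: "f \<in> hom C A B \<Longrightarrow> g \<in> hom C B D \<Longrightarrow> g \<circ> f \<in> hom C A D"
    and Comp_Idt: "f \<in> hom C A B \<Longrightarrow> f \<circ> Idt C A = f"
    and Idt_Comp: "f \<in> hom C A B \<Longrightarrow> Idt C B \<circ> f = f"
    and Comp_assoc: "f \<in> hom C A B \<Longrightarrow> g \<in> hom C B D \<Longrightarrow> h \<in> hom C D E \<Longrightarrow>
           h \<circ> (g \<circ> f) = (h \<circ> g) \<circ> f"

definition op_cat :: "('o, 'a) cat \<Rightarrow> ('o, 'a) cat" where
  "op_cat C = C\<lparr>Dom := Cod C, Cod := Dom C, Comp := (\<lambda>g f. f \<circ>\<^bsub>C\<^esub> g)\<rparr>"

definition iso :: "('o, 'a) cat \<Rightarrow> 'a \<Rightarrow> bool" where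
  "iso C f \<longleftrightarrow> f \<in> Arr C \<and> (\<exists>g \<in> hom C (Cod C f) (Dom C f).
     g \<circ>\<^bsub>C\<^esub> f = Idt C (Dom C f) \<and> f \<circ>\<^bsub>C\<^esub> g = Idt C (Cod C f))"

locale is_functor =
  fixes C :: "('o, 'a) cat" and D :: "('p, 'b) cat" and Fo :: "'o \<Rightarrow> 'p" and Fa :: "'a \<Rightarrow> 'b"
  assumes Fo_Obj: "A \<in> Obj C \<Longrightarrow> Fo A \<in> Obj D"
    and Fa_hom: "f \<in> hom C A B \<Longrightarrow> Fa f \<in> hom D (Fo A) (Fo B)"
    and Fa_Idt: "A \<in> Obj C \<Longrightarrow> Fa (Idt C A) = Idt D (Fo A)"
    and Fa_Comp: "f \<in> hom C A B \<Longrightarrow> g \<in> hom C B E \<Longrightarrow> Fa (g \<circ>\<^bsub>C\<^esub> f) = Fa g \<circ>\<^bsub>D\<^esub> Fa f"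

definition nat_trans :: "('o, 'a) cat \<Rightarrow> ('p, 'b) cat \<Rightarrow> ('o \<Rightarrow> 'p) \<Rightarrow> ('a \<Rightarrow> 'b) \<Rightarrow>
    ('o \<Rightarrow> 'p) \<Rightarrow> ('a \<Rightarrow> 'b) \<Rightarrow> ('o \<Rightarrow> 'b) \<Rightarrow> bool" where
  "nat_trans C D Fo Fa Go Ga \<tau> \<longleftrightarrow>
     (\<forall>A \<in> Obj C. \<tau> A \<in> hom D (Fo A) (Go A)) \<and>
     (\<forall>f \<in> Arr C. \<tau> (Cod C f) \<circ>\<^bsub>D\<^esub> Fa f = Ga f \<circ>\<^bsub>D\<^esub> \<tau> (Dom C f))"

definition surjective_on_objects ::
    "('o, 'a) cat \<Rightarrow> ('p, 'b) cat \<Rightarrow> ('o \<Rightarrow> 'p) \<Rightarrow> bool" where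
  "surjective_on_objects C D Fo \<longleftrightarrow> Fo ` Obj C = Obj D"

definition full_functor ::
    "('o, 'a) cat \<Rightarrow> ('p, 'b) cat \<Rightarrow> ('o \<Rightarrow> 'p) \<Rightarrow> ('a \<Rightarrow> 'b) \<Rightarrow> bool" where
  "full_functor C D Fo Fa \<longleftrightarrow>
     (\<forall>A \<in> Obj C. \<forall>B \<in> Obj C. Fa ` hom C A B = hom D (Fo A) (Fo B))"

definition cocone :: "('i, 'j) cat \<Rightarrow> ('o, 'a) cat \<Rightarrow> ('i \<Rightarrow> 'o) \<Rightarrow> ('j \<Rightarrow> 'a) \<Rightarrow>
    'o \<Rightarrow> ('i \<Rightarrow> 'a) \<Rightarrow> bool" where
  "cocone J C Do Da x c \<longleftrightarrow> x \<in> Obj C \<and> (\<forall>j \<in> Obj J. c j \<in> hom C (Do j) x) \<and>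
     (\<forall>u \<in> Arr J. c (Cod J u) \<circ>\<^bsub>C\<^esub> Da u = c (Dom J u))"

definition is_colimit :: "('i, 'j) cat \<Rightarrow> ('o, 'a) cat \<Rightarrow> ('i \<Rightarrow> 'o) \<Rightarrow> ('j \<Rightarrow> 'a) \<Rightarrow>
    'o \<Rightarrow> ('i \<Rightarrow> 'a) \<Rightarrow> bool" where
  "is_colimit J C Do Da x c \<longleftrightarrow> cocone J C Do Da x c \<and>
     (\<forall>y d. cocone J C Do Da y d \<longrightarrow>
        (\<exists>!h. h \<in> hom C x y \<and> (\<forall>j \<in> Obj J. h \<circ>\<^bsub>C\<^esub> c j = d j)))"

definition is_limit :: "('i, 'j) cat \<Rightarrow> ('o, 'a) cat \<Rightarrow> ('i \<Rightarrow> 'o) \<Rightarrow> ('j \<Rightarrow> 'a) \<Rightarrow>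
    'o \<Rightarrow> ('i \<Rightarrow> 'a) \<Rightarrow> bool" where
  "is_limit J C Do Da x c \<longleftrightarrow> is_colimit (op_cat J) (op_cat C) Do Da x c"

text \<open>HOL has no quantifier over types inside a formula, so ``small'' is relative to a
  type \<open>'i\<close>, passed as an \<open>itself\<close> argument: the small index categories are those whose objects and
  arrows form sets of elements of \<open>'i\<close>.\<close>

definition cocomplete :: "'i itself \<Rightarrow> ('o, 'a) cat \<Rightarrow> bool" where
  "cocomplete _ C \<longleftrightarrow> (\<forall>(J :: ('i, 'i) cat) Do Da.
     category J \<and> is_functor J C Do Da \<longrightarrow> (\<exists>x c. is_colimit J C Do Da x c))"

definition complete :: "'i itself \<Rightarrow> ('o, 'a) cat \<Rightarrow> bool" where
  "complete _ C \<longleftrightarrow> (\<forall>(J :: ('i, 'i) cat) Do Da.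
     category J \<and> is_functor J C Do Da \<longrightarrow> (\<exists>x c. is_limit J C Do Da x c))"

definition preserves_colimits :: "'i itself \<Rightarrow> ('o, 'a) cat \<Rightarrow> ('p, 'b) cat \<Rightarrow>
    ('o \<Rightarrow> 'p) \<Rightarrow> ('a \<Rightarrow> 'b) \<Rightarrow> bool" where
  "preserves_colimits _ C D Fo Fa \<longleftrightarrow> (\<forall>(J :: ('i, 'i) cat) Do Da x c.
     category J \<and> is_functor J C Do Da \<and> is_colimit J C Do Da x c \<longrightarrow>
     is_colimit J D (Fo \<circ> Do) (Fa \<circ> Da) (Fo x) (Fa \<circ> c))"

definition two_out_of_three :: "('o, 'a) cat \<Rightarrow> 'a set \<Rightarrow> bool" where
  "two_out_of_three C W \<longleftrightarrow> (\<forall>f \<in> Arr C. \<forall>g \<in> Arr C. Cod C f = Dom C g \<longrightarrow>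
     (f \<in> W \<and> g \<in> W \<longrightarrow> g \<circ>\<^bsub>C\<^esub> f \<in> W) \<and>
     (f \<in> W \<and> g \<circ>\<^bsub>C\<^esub> f \<in> W \<longrightarrow> g \<in> W) \<and>
     (g \<in> W \<and> g \<circ>\<^bsub>C\<^esub> f \<in> W \<longrightarrow> f \<in> W))"

definition retract_of :: "('o, 'a) cat \<Rightarrow> 'a \<Rightarrow> 'a \<Rightarrow> bool" where
  "retract_of C f g \<longleftrightarrow> f \<in> Arr C \<and> g \<in> Arr C \<and>
     (\<exists>i \<in> hom C (Dom C f) (Dom C g). \<exists>r \<in> hom C (Dom C g) (Dom C f).
      \<exists>i' \<in> hom C (Cod C f) (Cod C g). \<exists>r' \<in> hom C (Cod C g) (Cod C f).
        r \<circ>\<^bsub>C\<^esub> i = Idt C (Dom C f) \<and> r' \<circ>\<^bsub>C\<^esub> i' = Idt C (Cod C f) \<and>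
        g \<circ>\<^bsub>C\<^esub> i = i' \<circ>\<^bsub>C\<^esub> f \<and> f \<circ>\<^bsub>C\<^esub> r = r' \<circ>\<^bsub>C\<^esub> g)"

definition retract_closed :: "('o, 'a) cat \<Rightarrow> 'a set \<Rightarrow> bool" where
  "retract_closed C K \<longleftrightarrow> (\<forall>f g. retract_of C f g \<and> g \<in> K \<longrightarrow> f \<in> K)"

definition lifts_against :: "('o, 'a) cat \<Rightarrow> 'a \<Rightarrow> 'a \<Rightarrow> bool" where
  "lifts_against C i p \<longleftrightarrow>
     (\<forall>a \<in> hom C (Dom C i) (Dom C p). \<forall>b \<in> hom C (Cod C i) (Cod C p).
        p \<circ>\<^bsub>C\<^esub> a = b \<circ>\<^bsub>C\<^esub> i \<longrightarrow>
        (\<exists>h \<in> hom C (Cod C i) (Dom C p). h \<circ>\<^bsub>C\<^esub> i = a \<and> p \<circ>\<^bsub>C\<^esub> h = b))"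

text \<open>The factorizations are not required to be functorial.\<close>

locale model_category = category C for C :: "('o, 'a) cat" (structure) +
  fixes idx :: "'i itself" and W Cof Fib :: "'a set"
  assumes complete: "complete idx C"
    and cocomplete: "cocomplete idx C"
    and W_Arr: "W \<subseteq> Arr C" and Cof_Arr: "Cof \<subseteq> Arr C" and Fib_Arr: "Fib \<subseteq> Arr C"
    and W_two_out_of_three: "two_out_of_three C W"
    and W_retract: "retract_closed C W"
    and Cof_retract: "retract_closed C Cof"
    and Fib_retract: "retract_closed C Fib"
    and lift_Cof_trivFib: "i \<in> Cof \<Longrightarrow> p \<in> Fib \<inter> W \<Longrightarrow> lifts_against C i p"
    and lift_trivCof_Fib: "i \<in> Cof \<inter> W \<Longrightarrow> p \<in> Fib \<Longrightarrow> lifts_against C i p"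
    and factor_Cof_trivFib:
      "f \<in> Arr C \<Longrightarrow> \<exists>i \<in> Cof. \<exists>p \<in> Fib \<inter> W. Cod C i = Dom C p \<and> p \<circ> i = f"
    and factor_trivCof_Fib:
      "f \<in> Arr C \<Longrightarrow> \<exists>i \<in> Cof \<inter> W. \<exists>p \<in> Fib. Cod C i = Dom C p \<and> p \<circ> i = f"

definition initial :: "('o, 'a) cat \<Rightarrow> 'o \<Rightarrow> bool" where
  "initial C z \<longleftrightarrow> z \<in> Obj C \<and> (\<forall>x \<in> Obj C. \<exists>!h. h \<in> hom C z x)"

definition cofibrant :: "('o, 'a) cat \<Rightarrow> 'a set \<Rightarrow> 'o \<Rightarrow> bool" where
  "cofibrant C Cof x \<longleftrightarrow> (\<exists>z. initial C z \<and> (\<exists>h \<in> hom C z x. h \<in> Cof))"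

text \<open>All 1-cells, and all 2-cells, live in one carrier each; the hom-category between two objects
  is \<open>hom_cat\<close> below. Vertical composition \<open>\<beta> \<cdot> \<alpha>\<close> is ``\<open>\<beta>\<close> after \<open>\<alpha>\<close>'', whereas horizontal
  composition is in diagrammatic order: \<open>f \<otimes> g\<close> goes from \<open>Src f\<close> to \<open>Trg g\<close>.\<close>

record ('o, 'm, 't) semibicat =
  Ob :: "'o set"
  Mor1 :: "'m set"
  Src :: "'m \<Rightarrow> 'o"
  Trg :: "'m \<Rightarrow> 'o"
  Mor2 :: "'t set"
  Dom2 :: "'t \<Rightarrow> 'm"
  Cod2 :: "'t \<Rightarrow> 'm"
  Id2 :: "'m \<Rightarrow> 't"
  VComp :: "'t \<Rightarrow> 't \<Rightarrow> 't" (infixl "\<cdot>\<index>" 65)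
  HComp1 :: "'m \<Rightarrow> 'm \<Rightarrow> 'm" (infixl "\<otimes>\<index>" 70)
  HComp2 :: "'t \<Rightarrow> 't \<Rightarrow> 't" (infixl "\<star>\<index>" 70)
  Assoc :: "'m \<Rightarrow> 'm \<Rightarrow> 'm \<Rightarrow> 't"

definition hom1 :: "('o, 'm, 't, 'z) semibicat_scheme \<Rightarrow> 'o \<Rightarrow> 'o \<Rightarrow> 'm set" where
  "hom1 X U V = {f \<in> Mor1 X. Src X f = U \<and> Trg X f = V}"

definition hom2 :: "('o, 'm, 't, 'z) semibicat_scheme \<Rightarrow> 'm \<Rightarrow> 'm \<Rightarrow> 't set" where
  "hom2 X f g = {\<alpha> \<in> Mor2 X. Dom2 X \<alpha> = f \<and> Cod2 X \<alpha> = g}"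

definition hom_cat :: "('o, 'm, 't, 'z) semibicat_scheme \<Rightarrow> 'o \<Rightarrow> 'o \<Rightarrow> ('m, 't) cat" where
  "hom_cat X U V =
     \<lparr>Obj = hom1 X U V,
      Arr = {\<alpha> \<in> Mor2 X. Dom2 X \<alpha> \<in> hom1 X U V \<and> Cod2 X \<alpha> \<in> hom1 X U V},
      Dom = Dom2 X, Cod = Cod2 X, Idt = Id2 X, Comp = VComp X\<rparr>"

definition inverse2 :: "('o, 'm, 't, 'z) semibicat_scheme \<Rightarrow> 't \<Rightarrow> 't" where
  "inverse2 X \<alpha> = (THE \<beta>. \<beta> \<in> hom2 X (Cod2 X \<alpha>) (Dom2 X \<alpha>) \<and>
     \<beta> \<cdot>\<^bsub>X\<^esub> \<alpha> = Id2 X (Dom2 X \<alpha>) \<and> \<alpha> \<cdot>\<^bsub>X\<^esub> \<beta> = Id2 X (Cod2 X \<alpha>))"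

locale semi_bicategory =
  fixes X :: "('o, 'm, 't, 'z) semibicat_scheme" (structure)
  assumes Src_Ob: "f \<in> Mor1 X \<Longrightarrow> Src X f \<in> Ob X"
    and Trg_Ob: "f \<in> Mor1 X \<Longrightarrow> Trg X f \<in> Ob X"
    and Dom2_Mor1: "\<alpha> \<in> Mor2 X \<Longrightarrow> Dom2 X \<alpha> \<in> Mor1 X"
    and Cod2_Mor1: "\<alpha> \<in> Mor2 X \<Longrightarrow> Cod2 X \<alpha> \<in> Mor1 X"
    and parallel_Src: "\<alpha> \<in> Mor2 X \<Longrightarrow> Src X (Dom2 X \<alpha>) = Src X (Cod2 X \<alpha>)"
    and parallel_Trg: "\<alpha> \<in> Mor2 X \<Longrightarrow> Trg X (Dom2 X \<alpha>) = Trg X (Cod2 X \<alpha>)"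
    and category_hom_cat: "U \<in> Ob X \<Longrightarrow> V \<in> Ob X \<Longrightarrow> category (hom_cat X U V)"
    and HComp1_hom1: "f \<in> hom1 X U V \<Longrightarrow> g \<in> hom1 X V Z \<Longrightarrow> f \<otimes> g \<in> hom1 X U Z"
    and HComp2_hom2: "\<alpha> \<in> hom2 X f f' \<Longrightarrow> \<beta> \<in> hom2 X g g' \<Longrightarrow> Trg X f = Src X g \<Longrightarrow>
           \<alpha> \<star> \<beta> \<in> hom2 X (f \<otimes> g) (f' \<otimes> g')"
    and HComp2_Id2: "f \<in> Mor1 X \<Longrightarrow> g \<in> Mor1 X \<Longrightarrow> Trg X f = Src X g \<Longrightarrow>
           Id2 X f \<star> Id2 X g = Id2 X (f \<otimes> g)"
    and interchange: "\<alpha> \<in> hom2 X f f' \<Longrightarrow> \<alpha>' \<in> hom2 X f' f'' \<Longrightarrow>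
           \<beta> \<in> hom2 X g g' \<Longrightarrow> \<beta>' \<in> hom2 X g' g'' \<Longrightarrow> Trg X f = Src X g \<Longrightarrow>
           (\<alpha>' \<cdot> \<alpha>) \<star> (\<beta>' \<cdot> \<beta>) = (\<alpha>' \<star> \<beta>') \<cdot> (\<alpha> \<star> \<beta>)"
    and Assoc_hom2: "f \<in> hom1 X U V \<Longrightarrow> g \<in> hom1 X V Z \<Longrightarrow> h \<in> hom1 X Z T \<Longrightarrow>
           Assoc X f g h \<in> hom2 X ((f \<otimes> g) \<otimes> h) (f \<otimes> (g \<otimes> h))"
    and Assoc_iso: "f \<in> hom1 X U V \<Longrightarrow> g \<in> hom1 X V Z \<Longrightarrow> h \<in> hom1 X Z T \<Longrightarrow>
           iso (hom_cat X U T) (Assoc X f g h)"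
    and Assoc_natural: "\<alpha> \<in> hom2 X f f' \<Longrightarrow> \<beta> \<in> hom2 X g g' \<Longrightarrow> \<gamma> \<in> hom2 X h h' \<Longrightarrow>
           Trg X f = Src X g \<Longrightarrow> Trg X g = Src X h \<Longrightarrow>
           Assoc X f' g' h' \<cdot> ((\<alpha> \<star> \<beta>) \<star> \<gamma>) = (\<alpha> \<star> (\<beta> \<star> \<gamma>)) \<cdot> Assoc X f g h"
    and pentagon: "f \<in> hom1 X U V \<Longrightarrow> g \<in> hom1 X V Z \<Longrightarrow> h \<in> hom1 X Z T \<Longrightarrow> k \<in> hom1 X T S \<Longrightarrow>
           Assoc X f g (h \<otimes> k) \<cdot> Assoc X (f \<otimes> g) h k =
           (Id2 X f \<star> Assoc X g h k) \<cdot> Assoc X f (g \<otimes> h) k \<cdot> (Assoc X f g h \<star> Id2 X k)"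

record ('o, 'm, 't) bicat = "('o, 'm, 't) semibicat" +
  Unit1 :: "'o \<Rightarrow> 'm"
  LUnit :: "'m \<Rightarrow> 't"
  RUnit :: "'m \<Rightarrow> 't"

locale bicategory = semi_bicategory X for X :: "('o, 'm, 't) bicat" (structure) +
  assumes Unit1_hom1: "U \<in> Ob X \<Longrightarrow> Unit1 X U \<in> hom1 X U U"
    and LUnit_hom2: "f \<in> hom1 X U V \<Longrightarrow> LUnit X f \<in> hom2 X (Unit1 X U \<otimes> f) f"
    and RUnit_hom2: "f \<in> hom1 X U V \<Longrightarrow> RUnit X f \<in> hom2 X (f \<otimes> Unit1 X V) f"
    and LUnit_iso: "f \<in> hom1 X U V \<Longrightarrow> iso (hom_cat X U V) (LUnit X f)"
    and RUnit_iso: "f \<in> hom1 X U V \<Longrightarrow> iso (hom_cat X U V) (RUnit X f)"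
    and LUnit_natural: "f \<in> hom1 X U V \<Longrightarrow> \<alpha> \<in> hom2 X f f' \<Longrightarrow>
           LUnit X f' \<cdot> (Id2 X (Unit1 X U) \<star> \<alpha>) = \<alpha> \<cdot> LUnit X f"
    and RUnit_natural: "f \<in> hom1 X U V \<Longrightarrow> \<alpha> \<in> hom2 X f f' \<Longrightarrow>
           RUnit X f' \<cdot> (\<alpha> \<star> Id2 X (Unit1 X V)) = \<alpha> \<cdot> RUnit X f"
    and triangle: "f \<in> hom1 X U V \<Longrightarrow> g \<in> hom1 X V Z \<Longrightarrow>
           (Id2 X f \<star> LUnit X g) \<cdot> Assoc X f (Unit1 X V) g = RUnit X f \<star> Id2 X g"

text \<open>Reversing the 2-cells turns the associator into its inverse.\<close>

definition two_op :: "('o, 'm, 't) semibicat \<Rightarrow> ('o, 'm, 't) semibicat" where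
  "two_op X = X\<lparr>Dom2 := Cod2 X, Cod2 := Dom2 X, VComp := (\<lambda>\<beta> \<alpha>. \<alpha> \<cdot>\<^bsub>X\<^esub> \<beta>),
     Assoc := (\<lambda>f g h. inverse2 X (Assoc X f g h))\<rparr>"

locale base_of_enrichment = bicategory M for M :: "('o, 'm, 't) bicat" (structure) +
  fixes W :: "'t set"
  assumes W_Mor2: "W \<subseteq> Mor2 M"
    and W_iso: "U \<in> Ob M \<Longrightarrow> V \<in> Ob M \<Longrightarrow> iso (hom_cat M U V) \<alpha> \<Longrightarrow> \<alpha> \<in> W"
    and W_two_out_of_three: "U \<in> Ob M \<Longrightarrow> V \<in> Ob M \<Longrightarrow> two_out_of_three (hom_cat M U V) W"
    and W_HComp2: "\<alpha> \<in> W \<Longrightarrow> \<beta> \<in> W \<Longrightarrow> Trg M (Dom2 M \<alpha>) = Src M (Dom2 M \<beta>) \<Longrightarrow> \<alpha> \<star> \<beta> \<in> W"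

locale special_Quillen_algebra = bicategory M for M :: "('o, 'm, 't) bicat" (structure) +
  fixes idx :: "'i itself" and W Cof Fib :: "'t set"
  assumes W_Mor2: "W \<subseteq> Mor2 M" and Cof_Mor2: "Cof \<subseteq> Mor2 M" and Fib_Mor2: "Fib \<subseteq> Mor2 M"
    and model_hom_cat: "U \<in> Ob M \<Longrightarrow> V \<in> Ob M \<Longrightarrow>
           model_category (hom_cat M U V) idx (W \<inter> Arr (hom_cat M U V))
             (Cof \<inter> Arr (hom_cat M U V)) (Fib \<inter> Arr (hom_cat M U V))"
    and colimits_right: "f \<in> hom1 M U V \<Longrightarrow> Z \<in> Ob M \<Longrightarrow>
           preserves_colimits idx (hom_cat M V Z) (hom_cat M U Z)
             (\<lambda>g. f \<otimes> g) (\<lambda>\<beta>. Id2 M f \<star> \<beta>)"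
    and colimits_left: "g \<in> hom1 M V Z \<Longrightarrow> U \<in> Ob M \<Longrightarrow>
           preserves_colimits idx (hom_cat M U V) (hom_cat M U Z)
             (\<lambda>f. f \<otimes> g) (\<lambda>\<alpha>. \<alpha> \<star> Id2 M g)"
    and Cof_HComp2: "\<alpha> \<in> Cof \<Longrightarrow> \<beta> \<in> Cof \<Longrightarrow>
           Dom2 M \<alpha> \<in> hom1 M U V \<Longrightarrow> Dom2 M \<beta> \<in> hom1 M V Z \<Longrightarrow>
           cofibrant (hom_cat M U V) Cof (Dom2 M \<alpha>) \<Longrightarrow>
           cofibrant (hom_cat M V Z) Cof (Dom2 M \<beta>) \<Longrightarrow> \<alpha> \<star> \<beta> \<in> Cof"
    and trivCof_HComp2: "\<alpha> \<in> Cof \<inter> W \<Longrightarrow> \<beta> \<in> Cof \<inter> W \<Longrightarrow>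
           Dom2 M \<alpha> \<in> hom1 M U V \<Longrightarrow> Dom2 M \<beta> \<in> hom1 M V Z \<Longrightarrow>
           cofibrant (hom_cat M U V) Cof (Dom2 M \<alpha>) \<Longrightarrow>
           cofibrant (hom_cat M V Z) Cof (Dom2 M \<beta>) \<Longrightarrow> \<alpha> \<star> \<beta> \<in> Cof \<inter> W"

record ('o, 'm, 't, 'p, 'n, 's) lax =
  F0 :: "'o \<Rightarrow> 'p"
  F1 :: "'m \<Rightarrow> 'n"
  F2 :: "'t \<Rightarrow> 's"
  Lax :: "'m \<Rightarrow> 'm \<Rightarrow> 's"

locale lax_morphism =
  fixes X :: "('o, 'm, 't, 'z) semibicat_scheme"
    and Y :: "('p, 'n, 's, 'y) semibicat_scheme" (structure)
    and F :: "('o, 'm, 't, 'p, 'n, 's) lax"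
  assumes F0_Ob: "A \<in> Ob X \<Longrightarrow> F0 F A \<in> Ob Y"
    and functor_hom: "A \<in> Ob X \<Longrightarrow> B \<in> Ob X \<Longrightarrow>
           is_functor (hom_cat X A B) (hom_cat Y (F0 F A) (F0 F B)) (F1 F) (F2 F)"
    and Lax_hom2: "f \<in> hom1 X A B \<Longrightarrow> g \<in> hom1 X B E \<Longrightarrow>
           Lax F f g \<in> hom2 Y (F1 F f \<otimes> F1 F g) (F1 F (f \<otimes>\<^bsub>X\<^esub> g))"
    and Lax_natural: "\<alpha> \<in> hom2 X f f' \<Longrightarrow> \<beta> \<in> hom2 X g g' \<Longrightarrow>
           f \<in> hom1 X A B \<Longrightarrow> g \<in> hom1 X B E \<Longrightarrow>
           F2 F (\<alpha> \<star>\<^bsub>X\<^esub> \<beta>) \<cdot> Lax F f g = Lax F f' g' \<cdot> (F2 F \<alpha> \<star> F2 F \<beta>)"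
    and Lax_associative: "f \<in> hom1 X A B \<Longrightarrow> g \<in> hom1 X B E \<Longrightarrow> h \<in> hom1 X E K \<Longrightarrow>
           F2 F (Assoc X f g h) \<cdot> Lax F (f \<otimes>\<^bsub>X\<^esub> g) h \<cdot> (Lax F f g \<star> Id2 Y (F1 F h)) =
           Lax F f (g \<otimes>\<^bsub>X\<^esub> h) \<cdot> (Id2 Y (F1 F f) \<star> Lax F g h) \<cdot> Assoc Y (F1 F f) (F1 F g) (F1 F h)"

text \<open>Icons: transformations between lax morphisms that agree on objects, with 2-cells as components.\<close>

definition lax_transformation ::
    "('o, 'm, 't, 'z) semibicat_scheme \<Rightarrow> ('p, 'n, 's, 'y) semibicat_scheme \<Rightarrow>
     ('o, 'm, 't, 'p, 'n, 's) lax \<Rightarrow> ('o, 'm, 't, 'p, 'n, 's) lax \<Rightarrow> ('m \<Rightarrow> 's) \<Rightarrow> bool" where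
  "lax_transformation X Y F G \<sigma> \<longleftrightarrow>
     (\<forall>A \<in> Ob X. F0 F A = F0 G A) \<and>
     (\<forall>A \<in> Ob X. \<forall>B \<in> Ob X.
        nat_trans (hom_cat X A B) (hom_cat Y (F0 F A) (F0 F B)) (F1 F) (F2 F) (F1 G) (F2 G) \<sigma>) \<and>
     (\<forall>f \<in> Mor1 X. \<forall>g \<in> Mor1 X. Trg X f = Src X g \<longrightarrow>
        \<sigma> (f \<otimes>\<^bsub>X\<^esub> g) \<cdot>\<^bsub>Y\<^esub> Lax F f g = Lax G f g \<cdot>\<^bsub>Y\<^esub> (\<sigma> f \<star>\<^bsub>Y\<^esub> \<sigma> g))"

definition arrow_chains :: "('o, 'a) cat \<Rightarrow> 'a list set" where
  "arrow_chains C = {s. s \<noteq> [] \<and> set s \<subseteq> Arr C \<and>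
     (\<forall>i. Suc i < length s \<longrightarrow> Cod C (s ! i) = Dom C (s ! Suc i))}"

fun composite :: "('o, 'a) cat \<Rightarrow> 'a list \<Rightarrow> 'a" where
  "composite C [f] = f"
| "composite C (f # g # s) = composite C (g # s) \<circ>\<^bsub>C\<^esub> f"

text \<open>A 2-cell from \<open>s\<close> to \<open>t\<close> is a triple \<open>(s, p, t)\<close>, where the list \<open>p\<close> of length \<open>length s\<close>
  is the table of values of a map \<open>{0..<length s} \<rightarrow> {0..<length t}\<close>;
  \<open>nths s {i. p ! i = j}\<close> is the part of \<open>s\<close> lying over \<open>j\<close>.\<close>

definition chain_maps :: "('o, 'a) cat \<Rightarrow> ('a list \<times> nat list \<times> 'a list) set" where
  "chain_maps C = {(s, p, t). s \<in> arrow_chains C \<and> t \<in> arrow_chains C \<and>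
     length p = length s \<and> sorted p \<and> set p = {0..<length t} \<and>
     (\<forall>j < length t. t ! j = composite C (nths s {i. p ! i = j}))}"

definition chain_semibicat ::
    "('o, 'a) cat \<Rightarrow> ('o, 'a list, 'a list \<times> nat list \<times> 'a list) semibicat" where
  "chain_semibicat C =
     \<lparr>Ob = Obj C,
      Mor1 = arrow_chains C,
      Src = (\<lambda>s. Dom C (hd s)),
      Trg = (\<lambda>s. Cod C (last s)),
      Mor2 = chain_maps C,
      Dom2 = (\<lambda>(s, p, t). s),
      Cod2 = (\<lambda>(s, p, t). t),
      Id2 = (\<lambda>s. (s, [0..<length s], s)),
      VComp = (\<lambda>(t, q, r) (s, p, t'). (s, map (\<lambda>k. q ! k) p, r)),
      HComp1 = (\<lambda>s s'. s @ s'),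
      HComp2 = (\<lambda>(s, p, t) (s', p', t'). (s @ s', p @ map (\<lambda>k. length t + k) p', t @ t')),
      Assoc = (\<lambda>s t r. (s @ t @ r, [0..<length (s @ t @ r)], s @ t @ r))\<rparr>"

type_synonym ('c, 'a, 'o, 'm, 't) chain_lax =
  "('c, 'a list, 'a list \<times> nat list \<times> 'a list, 'o, 'm, 't) lax"

definition S_diagram ::
    "('o, 'm, 't) bicat \<Rightarrow> ('c, 'a) cat \<Rightarrow> ('c, 'a, 'o, 'm, 't) chain_lax \<Rightarrow> bool" where
  "S_diagram M C F \<longleftrightarrow> lax_morphism (two_op (chain_semibicat C)) M F"

definition co_Segal ::
    "'t set \<Rightarrow> ('c, 'a) cat \<Rightarrow> ('c, 'a, 'o, 'm, 't) chain_lax \<Rightarrow> bool" where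
  "co_Segal W C F \<longleftrightarrow> (\<forall>A \<in> Obj C. \<forall>B \<in> Obj C.
     \<forall>u \<in> Arr (hom_cat (chain_semibicat C) A B). F2 F u \<in> W)"

text \<open>The composite of \<open>G\<close> with the strict morphism induced by the functor \<open>(So, Sa)\<close>.\<close>

definition precompose :: "('c \<Rightarrow> 'd) \<Rightarrow> ('a \<Rightarrow> 'b) \<Rightarrow>
    ('d, 'b, 'o, 'm, 't) chain_lax \<Rightarrow> ('c, 'a, 'o, 'm, 't) chain_lax" where
  "precompose So Sa G =
     \<lparr>F0 = (\<lambda>A. F0 G (So A)),
      F1 = (\<lambda>s. F1 G (map Sa s)),
      F2 = (\<lambda>(s, p, t). F2 G (map Sa s, p, map Sa t)),
      Lax = (\<lambda>s t. Lax G (map Sa s) (map Sa t))\<rparr>"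

definition S_diagram_morphism :: "('o, 'm, 't) bicat \<Rightarrow> ('c, 'a) cat \<Rightarrow> ('d, 'b) cat \<Rightarrow>
    ('c, 'a, 'o, 'm, 't) chain_lax \<Rightarrow> ('d, 'b, 'o, 'm, 't) chain_lax \<Rightarrow>
    ('c \<Rightarrow> 'd) \<Rightarrow> ('a \<Rightarrow> 'b) \<Rightarrow> ('a list \<Rightarrow> 't) \<Rightarrow> bool" where
  "S_diagram_morphism M C D F G So Sa \<sigma> \<longleftrightarrow> is_functor C D So Sa \<and>
     lax_transformation (two_op (chain_semibicat C)) M F (precompose So Sa G) \<sigma>"

definition levelwise_weak_equivalence ::
    "'t set \<Rightarrow> ('c, 'a) cat \<Rightarrow> ('a list \<Rightarrow> 't) \<Rightarrow> bool" where
  "levelwise_weak_equivalence W C \<sigma> \<longleftrightarrow> (\<forall>s \<in> arrow_chains C. \<sigma> s \<in> W)"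

end

theory Submission
  imports Defs
begin

text \<open>Naturality of \<open>\<sigma>\<close> at a 2-cell \<open>u\<close> is a commutative square in a hom-category of \<open>M\<close> with sides
  \<open>F u\<close> and \<open>G (\<Sigma> u)\<close>, whose other two sides are components of \<open>\<sigma>\<close>; by 2-out-of-3, \<open>F u\<close> is a
  weak equivalence iff \<open>G (\<Sigma> u)\<close> is. For (2), every 2-cell \<open>v\<close> over \<open>D\<close> is some \<open>\<Sigma> u\<close>: choose
  preimages of the objects along the source chain of \<open>v\<close>, lift its arrows by fullness, and take as
  target the composites in \<open>C\<close> of the lifted arrows over each point.\<close>

section \<open>Two-out-of-three for commutative squares\<close>

lemma two_out_of_three_Int_Arr:
  assumes "category C"
  shows "two_out_of_three C (W \<inter> Arr C) \<longleftrightarrow> two_out_of_three C W"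
proof -
  have "g \<circ>\<^bsub>C\<^esub> f \<in> Arr C" if "f \<in> Arr C" "g \<in> Arr C" "Cod C f = Dom C g" for f g
    using category.Comp_hom[OF assms, of f "Dom C f" "Cod C f" g "Cod C g"] that
    by (auto simp: hom_def)
  then show ?thesis
    by (auto simp: two_out_of_three_def)
qed

text \<open>Since \<open>b\<close> and \<open>c\<close> are in \<open>W\<close>, membership of
  either \<open>a\<close> or \<open>d\<close> is equivalent to membership of the common diagonal of
  the square.\<close>

lemma two_out_of_three_square:
  assumes W: "two_out_of_three C W"
    and "a \<in> hom C w x" "b \<in> hom C x z" "c \<in> hom C w y" "d \<in> hom C y z"
    and sq: "b \<circ>\<^bsub>C\<^esub> a = d \<circ>\<^bsub>C\<^esub> c" and bc: "b \<in> W" "c \<in> W"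
  shows "a \<in> W \<longleftrightarrow> d \<in> W"
proof -
  have arr: "a \<in> Arr C" "b \<in> Arr C" "Cod C a = Dom C b" "c \<in> Arr C" "d \<in> Arr C" "Cod C c = Dom C d"
    using assms(2-5) by (auto simp: hom_def)
  have "a \<in> W \<longleftrightarrow> b \<circ>\<^bsub>C\<^esub> a \<in> W"
    using W arr(1-3) bc(1) unfolding two_out_of_three_def by blast
  moreover have "d \<in> W \<longleftrightarrow> d \<circ>\<^bsub>C\<^esub> c \<in> W"
    using W arr(4-6) bc(2) unfolding two_out_of_three_def by blast
  ultimately show ?thesis
    using sq by simp
qed

section \<open>Chains of arrows, their composites, and their images and lifts along a
  functor\<close>

lemma arrow_chains_iff:
  "s \<in> arrow_chains C \<longleftrightarrow>
     s \<noteq> [] \<and> set s \<subseteq> Arr C \<and> successively (\<lambda>f g. Cod C f = Dom C g) s"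
  by (auto simp: arrow_chains_def successively_conv_nth)

lemma arrow_chains_Cons:
  "f # s \<in> arrow_chains C \<longleftrightarrow>
     f \<in> Arr C \<and> (s = [] \<or> s \<in> arrow_chains C \<and> Cod C f = Dom C (hd s))"
  by (auto simp: arrow_chains_iff successively_Cons)

lemma composite_hom:
  assumes "category C" "s \<in> arrow_chains C"
  shows "composite C s \<in> hom C (Dom C (hd s)) (Cod C (last s))"
  using assms(2)
proof (induction s rule: induct_list012)
  case (3 f g s)
  then have "f \<in> hom C (Dom C f) (Dom C g)"
      "composite C (g # s) \<in> hom C (Dom C g) (Cod C (last (g # s)))"
    by (auto simp: arrow_chains_Cons hom_def)
  from category.Comp_hom[OF assms(1) this] show ?case
    by simp
qed (auto simp: arrow_chains_iff hom_def)

lemma arrow_chains_map: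
  assumes "is_functor C D So Sa" "s \<in> arrow_chains C"
  shows "map Sa s \<in> arrow_chains D"
proof -
  have "Sa f \<in> Arr D \<and> Dom D (Sa f) = So (Dom C f) \<and> Cod D (Sa f) = So (Cod C f)"
    if "f \<in> Arr C" for f
    using is_functor.Fa_hom[OF assms(1), of f "Dom C f" "Cod C f"] that by (auto simp: hom_def)
  then show ?thesis
    using assms(2) unfolding arrow_chains_iff successively_map
    by (auto simp: subset_iff elim: successively_mono)
qed

lemma composite_map:
  assumes "category C" "is_functor C D So Sa" "s \<in> arrow_chains C"
  shows "composite D (map Sa s) = Sa (composite C s)"
  using assms(3)
proof (induction s rule: induct_list012)
  case (3 f g s)
  then have "f \<in> hom C (Dom C f) (Dom C g)" "g # s \<in> arrow_chains C"
    by (auto simp: arrow_chains_Cons hom_def)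
  from is_functor.Fa_Comp[OF assms(2) this(1)] composite_hom[OF assms(1) this(2)] 3 show ?case
    by (simp add: arrow_chains_Cons)
qed (auto simp: arrow_chains_iff)

text \<open>Arrows lifted one at a time need not be composable. Prescribing the starting object
  \<open>A\<close>, and generalizing over it in the induction, makes each lifted arrow start where
  the previous one ends.\<close>

lemma arrow_chains_lift:
  assumes "category D" "is_functor C D So Sa" "surjective_on_objects C D So"
    "full_functor C D So Sa" "s \<in> arrow_chains D" "A \<in> Obj C" "So A = Dom D (hd s)"
  shows "\<exists>s' \<in> arrow_chains C. map Sa s' = s \<and> Dom C (hd s') = A"
  using assms(5-)
proof (induction s arbitrary: A)
  case Nil
  then show ?case by (simp add: arrow_chains_iff)
next
  case (Cons f s)
  have f: "f \<in> Arr D"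
    using Cons.prems by (simp add: arrow_chains_Cons)
  \<comment> \<open>The end object is lifted before the arrow: fullness then applies to the arrows
    from \<open>A\<close> to \<open>B\<close>, and \<open>B\<close> is the prescribed start for the
    tail.\<close>
  then obtain B where B: "B \<in> Obj C" "So B = Cod D f"
    using category.Cod_Obj[OF assms(1)] assms(3) by (force simp: surjective_on_objects_def)
  have "f \<in> hom D (So A) (So B)"
    using f B Cons.prems by (simp add: hom_def)
  then obtain f' where f': "f' \<in> hom C A B" "Sa f' = f"
    using assms(4) Cons.prems B unfolding full_functor_def by (metis imageE)
  show ?case
  proof (cases "s = []")
    case True
    then show ?thesis
      using f' by (intro bexI[of _ "[f']"]) (auto simp: arrow_chains_Cons hom_def)
  next
    case False
    then obtain s' where "s' \<in> arrow_chains C" "map Sa s' = s" "Dom C (hd s') = B"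
      using Cons.IH[OF _ B(1)] Cons.prems B by (auto simp: arrow_chains_Cons)
    then show ?thesis
      using f' by (intro bexI[of _ "f' # s'"]) (auto simp: arrow_chains_Cons hom_def)
  qed
qed

section \<open>Cutting a chain into the fibres of a monotone map\<close>

lemma nths_Un_append:
  assumes "\<And>i j. i \<in> I \<Longrightarrow> j \<in> J \<Longrightarrow> j < length s \<Longrightarrow> i < j"
  shows "nths s (I \<union> J) = nths s I @ nths s J"
  using assms
proof (induction s arbitrary: I J)
  case (Cons x s)
  have IH: "nths s ({i. Suc i \<in> I} \<union> {j. Suc j \<in> J}) = nths s {i. Suc i \<in> I} @ nths s {j. Suc j \<in> J}"
    using Cons.prems by (intro Cons.IH) fastforce
  show ?case
  proof (cases "0 \<in> J")
    case True
    \<comment> \<open>Position 0 exists in \<open>x # s\<close>, and every element of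
      \<open>I\<close> would have to lie strictly below it.\<close>
    then have "I = {}"
      using Cons.prems by fastforce
    then show ?thesis by simp
  next
    case False
    then show ?thesis
      using IH by (simp add: nths_Cons Collect_disj_eq)
  qed
qed simp

text \<open>Monotonicity makes the fibres consecutive blocks: by induction on \<open>k\<close>,
  those over \<open>0, ..., k - 1\<close> together list the entries at positions with value below
  \<open>k\<close>.\<close>

lemma concat_fibres:
  assumes "sorted p" "length p = length s" "set p \<subseteq> {0..<m}"
  shows "concat (map (\<lambda>j. nths s {i. p ! i = j}) [0..<m]) = s"
proof -
  \<comment> \<open>\<open>p ! i\<close> is unspecified beyond the length of \<open>p\<close>, so
    the sets below may contain stray indices. \<open>nths\<close> ignores them; cutting them off
    lets sortedness compare the rest.\<close>
  have *: "nths s I = nths s {i. i < length s \<and> i \<in> I}" for I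
    by (auto simp: nths_def intro!: arg_cong[of _ _ "map fst"] filter_cong dest: set_zip_rightD)
  have "concat (map (\<lambda>j. nths s {i. p ! i = j}) [0..<k]) = nths s {i. p ! i < k}" for k
  proof (induction k)
    case (Suc k)
    have "nths s ({i. i < length s \<and> p ! i < k} \<union> {i. i < length s \<and> p ! i = k}) =
          nths s {i. i < length s \<and> p ! i < k} @ nths s {i. i < length s \<and> p ! i = k}"
    proof (rule nths_Un_append)
      fix i j
      assume "i \<in> {i. i < length s \<and> p ! i < k}" "j \<in> {i. i < length s \<and> p ! i = k}"
      then show "i < j"
        using sorted_nth_mono[OF assms(1), of j i] assms(2) by (cases "i < j") auto
    qed
    moreover have "{i. i < length s \<and> p ! i < k} \<union> {i. i < length s \<and> p ! i = k} =
        {i. i < length s \<and> p ! i < Suc k}"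
      by auto
    ultimately show ?case
      using Suc *[of "{i. p ! i < k}"] *[of "{i. p ! i = k}"] *[of "{i. p ! i < Suc k}"] by simp
  qed simp
  moreover have "nths s {i. p ! i < m} = s"
    using assms(2,3) by (intro nths_all) (auto simp: subset_iff)
  ultimately show ?thesis
    by simp
qed

text \<open>A nonempty block and its composite have the same end objects, so the composites match at
  the seams between blocks because the concatenated chain does.\<close>

lemma composites_of_blocks:
  assumes "category C" "bs \<noteq> []" "[] \<notin> set bs" "concat bs \<in> arrow_chains C"
  shows "set bs \<subseteq> arrow_chains C \<and> map (composite C) bs \<in> arrow_chains C \<and>
    Dom C (hd (map (composite C) bs)) = Dom C (hd (concat bs)) \<and>
    Cod C (last (map (composite C) bs)) = Cod C (last (concat bs))"
  using assms(2-)
proof (induction bs)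
  case (Cons b bs)
  then have b: "b \<in> arrow_chains C"
    by (auto simp: arrow_chains_iff successively_append_iff)
  note composite_hom[OF assms(1) b]
  then have b': "composite C b \<in> Arr C" "Dom C (composite C b) = Dom C (hd b)"
    "Cod C (composite C b) = Cod C (last b)"
    by (auto simp: hom_def)
  show ?case
  proof (cases "bs = []")
    case True
    then show ?thesis
      using b b' by (auto simp: arrow_chains_Cons)
  next
    case False
    then have ne: "concat bs \<noteq> []"
      using Cons.prems by (cases bs) auto
    then have "concat bs \<in> arrow_chains C" "Cod C (last b) = Dom C (hd (concat bs))"
      using Cons.prems by (auto simp: arrow_chains_iff successively_append_iff)
    then show ?thesis
      using Cons.IH Cons.prems False ne b b' by (auto simp: arrow_chains_Cons)
  qed
qed simp

text \<open>The action of the strict morphism induced by a functor on 2-cells. Chains keep their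
  length, so the same table \<open>p\<close> serves.\<close>

definition map_chain_map ::
    "('a \<Rightarrow> 'b) \<Rightarrow> 'a list \<times> nat list \<times> 'a list \<Rightarrow> 'b list \<times> nat list \<times> 'b list"
  where "map_chain_map h = (\<lambda>(s, p, t). (map h s, p, map h t))"

text \<open>A 2-cell out of \<open>s\<close> is determined by its table \<open>p\<close>. Any
  monotone surjective \<open>p\<close> yields a legitimate target \<open>t\<close>, with the end
  objects of \<open>s\<close>; this supplies the target when a 2-cell is lifted.\<close>

lemma fibres:
  assumes "s \<in> arrow_chains C" "length p = length s" "sorted p" "set p = {0..<m}"
    and "category C"
  defines "t \<equiv> map (\<lambda>j. composite C (nths s {i. p ! i = j})) [0..<m]"
  shows fibre_chain: "j < m \<Longrightarrow> nths s {i. p ! i = j} \<in> arrow_chains C"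
    and fibre_composites: "t \<in> arrow_chains C"
    and fibre_composites_Dom: "Dom C (hd t) = Dom C (hd s)"
    and fibre_composites_Cod: "Cod C (last t) = Cod C (last s)"
proof -
  let ?bs = "map (\<lambda>j. nths s {i. p ! i = j}) [0..<m]"
  have concat: "concat ?bs = s"
    using assms(2-4) by (intro concat_fibres) auto
  have map: "map (composite C) ?bs = t"
    by (simp add: t_def)
  \<comment> \<open>Surjectivity of \<open>p\<close> excludes empty blocks, on which
    \<open>composite\<close> would be unspecified.\<close>
  have "nths s {i. p ! i = j} \<noteq> []" if "j < m" for j
  proof -
    have "j \<in> set p"
      using that assms(4) by simp
    then obtain i where "i < length s" "p ! i = j"
      using assms(2) by (auto simp: in_set_conv_nth)
    then have "set (nths s {i. p ! i = j}) \<noteq> {}"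
      by (auto simp: set_nths)
    then show ?thesis by auto
  qed
  then have "[] \<notin> set ?bs"
    by fastforce
  \<comment> \<open>The blocks concatenate to the nonempty chain \<open>s\<close>, so there is at
    least one.\<close>
  moreover have "?bs \<noteq> []"
    using assms(1) concat by (force simp: arrow_chains_iff)
  ultimately have "set ?bs \<subseteq> arrow_chains C \<and> t \<in> arrow_chains C \<and>
      Dom C (hd t) = Dom C (hd s) \<and> Cod C (last t) = Cod C (last s)"
    using composites_of_blocks[OF assms(5), of ?bs] assms(1) unfolding concat map by blast
  then show "j < m \<Longrightarrow> nths s {i. p ! i = j} \<in> arrow_chains C" "t \<in> arrow_chains C"
      "Dom C (hd t) = Dom C (hd s)" "Cod C (last t) = Cod C (last s)"
    by auto
qed

section \<open>Images and lifts of 2-cells between chains\<close>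

lemma chain_maps_iff:
  "(s, p, t) \<in> chain_maps C \<longleftrightarrow> s \<in> arrow_chains C \<and> t \<in> arrow_chains C \<and>
     length p = length s \<and> sorted p \<and> set p = {0..<length t} \<and>
     t = map (\<lambda>j. composite C (nths s {i. p ! i = j})) [0..<length t]"
proof -
  have "t = map h [0..<length t] \<longleftrightarrow> (\<forall>j < length t. t ! j = h j)" for h
    by (subst list_eq_iff_nth_eq) simp
  then show ?thesis
    by (simp add: chain_maps_def)
qed

lemma Arr_chain_semibicat_iff:
  "(s, p, t) \<in> Arr (hom_cat (chain_semibicat C) A B) \<longleftrightarrow> (s, p, t) \<in> chain_maps C \<and>
     Dom C (hd s) = A \<and> Cod C (last s) = B \<and> Dom C (hd t) = A \<and> Cod C (last t) = B"
  by (auto simp: hom_cat_def chain_semibicat_def hom1_def chain_maps_def)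

lemma map_chain_map_Arr:
  assumes "category C" "is_functor C D So Sa"
    and "u \<in> Arr (hom_cat (chain_semibicat C) A B)"
  shows "map_chain_map Sa u \<in> Arr (hom_cat (chain_semibicat D) (So A) (So B))"
proof -
  obtain s p t where u: "u = (s, p, t)"
    by (cases u)
  have spt: "s \<in> arrow_chains C" "length p = length s" "sorted p" "set p = {0..<length t}"
    and t: "t \<in> arrow_chains C" "t = map (\<lambda>j. composite C (nths s {i. p ! i = j})) [0..<length t]"
    and ends: "Dom C (hd s) = A" "Cod C (last s) = B" "Dom C (hd t) = A" "Cod C (last t) = B"
    using assms(3) by (auto simp: u Arr_chain_semibicat_iff chain_maps_iff)
  have "Dom D (Sa f) = So (Dom C f) \<and> Cod D (Sa f) = So (Cod C f)" if "f \<in> Arr C" for f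
    using is_functor.Fa_hom[OF assms(2), of f "Dom C f" "Cod C f"] that by (auto simp: hom_def)
  then have *: "Dom D (hd (map Sa r)) = So (Dom C (hd r)) \<and>
      Cod D (last (map Sa r)) = So (Cod C (last r))"
    if "r \<in> arrow_chains C" for r
    using that by (auto simp: arrow_chains_iff hd_map last_map subset_iff)
  \<comment> \<open>The fibres of the mapped chain are the images of the fibres of \<open>s\<close>,
    and each is a chain, so \<open>Sa\<close> commutes with its composite.\<close>
  have "map Sa t = map (\<lambda>j. composite D (nths (map Sa s) {i. p ! i = j})) [0..<length t]"
    by (subst t(2)) (simp add: nths_map composite_map[OF assms(1,2) fibre_chain[OF spt assms(1)]])
  then have "(map Sa s, p, map Sa t) \<in> chain_maps D"
    using spt arrow_chains_map[OF assms(2) spt(1)] arrow_chains_map[OF assms(2) t(1)]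
    by (simp add: chain_maps_iff)
  then show ?thesis
    using * spt(1) t(1) ends by (simp add: u map_chain_map_def Arr_chain_semibicat_iff)
qed

lemma chain_map_lift:
  assumes "category C" "category D" "is_functor C D So Sa" "surjective_on_objects C D So"
    and "full_functor C D So Sa" "v \<in> Arr (hom_cat (chain_semibicat D) A B)"
  obtains A' B' u where "A' \<in> Obj C" "B' \<in> Obj C"
    "u \<in> Arr (hom_cat (chain_semibicat C) A' B')" "map_chain_map Sa u = v"
proof -
  obtain s p t where v: "v = (s, p, t)"
    by (cases v)
  have s: "s \<in> arrow_chains D"
    and p: "length p = length s" "sorted p" "set p = {0..<length t}"
    and t: "t = map (\<lambda>j. composite D (nths s {i. p ! i = j})) [0..<length t]"
    using assms(6) by (auto simp: v Arr_chain_semibicat_iff chain_maps_iff)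
  have "Dom D (hd s) \<in> Obj D"
    using s category.Dom_Obj[OF assms(2)] by (auto simp: arrow_chains_iff subset_iff)
  then obtain A' where A': "A' \<in> Obj C" "So A' = Dom D (hd s)"
    using assms(4) by (force simp: surjective_on_objects_def)
  obtain s' where s': "s' \<in> arrow_chains C" "map Sa s' = s" "Dom C (hd s') = A'"
    using arrow_chains_lift[OF assms(2-5) s A'] by auto
  have p': "length p = length s'"
    using p(1) s'(2) by auto
  \<comment> \<open>The target is forced by \<open>s'\<close> and \<open>p\<close>. Lifting
    \<open>t\<close> separately by fullness could give arrows that are not the composites of the
    fibres of \<open>s'\<close>.\<close>
  let ?t' = "map (\<lambda>j. composite C (nths s' {i. p ! i = j})) [0..<length t]"
  note fib = fibres[OF s'(1) p' p(2,3) assms(1)]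
  have "map Sa ?t' = t"
    by (subst t)
      (simp add: s'(2)[symmetric] nths_map composite_map[OF assms(1,3) fib(1)])
  \<comment> \<open>The second end object is not prescribed: it is wherever the lifted source chain
    ends, and \<open>fib(4)\<close> gives the target the same end.\<close>
  moreover have "(s', p, ?t') \<in> Arr (hom_cat (chain_semibicat C) A' (Cod C (last s')))"
    using s' p' p fib(2-4) by (simp add: Arr_chain_semibicat_iff chain_maps_iff)
  moreover have "Cod C (last s') \<in> Obj C"
    using s'(1) category.Cod_Obj[OF assms(1)] by (auto simp: arrow_chains_iff subset_iff)
  ultimately show thesis
    using that[OF A'(1)] s'(2) by (auto simp: map_chain_map_def v)
qed

section \<open>The naturality square and the transfer of the co-Segal condition\<close>

lemma weak_equivalence_iff:
  assumes W: "\<And>U V. U \<in> Ob M \<Longrightarrow> V \<in> Ob M \<Longrightarrow> two_out_of_three (hom_cat M U V) W"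
    and C: "category C"
    and F: "S_diagram M C F" and G: "S_diagram M D G"
    and mor: "S_diagram_morphism M C D F G So Sa \<sigma>"
    and weq: "levelwise_weak_equivalence W C \<sigma>"
    and A: "A \<in> Obj C" and B: "B \<in> Obj C"
    and u: "u \<in> Arr (hom_cat (chain_semibicat C) A B)"
  shows "F2 F u \<in> W \<longleftrightarrow> F2 G (map_chain_map Sa u) \<in> W"
proof -
  let ?SC = "two_op (chain_semibicat C)" and ?SD = "two_op (chain_semibicat D)"
  let ?H = "hom_cat M (F0 F A) (F0 F B)"
  let ?v = "map_chain_map Sa u"
  have \<Sigma>: "is_functor C D So Sa"
    and tr: "lax_transformation ?SC M F (precompose So Sa G) \<sigma>"
    using mor by (auto simp: S_diagram_morphism_def)
  interpret F: lax_morphism ?SC M F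
    using F by (simp add: S_diagram_def)
  interpret G: lax_morphism ?SD M G
    using G by (simp add: S_diagram_def)
  have Ob: "A \<in> Ob ?SC" "B \<in> Ob ?SC" "So A \<in> Ob ?SD" "So B \<in> Ob ?SD"
    using A B is_functor.Fo_Obj[OF \<Sigma>] by (auto simp: two_op_def chain_semibicat_def)
  \<comment> \<open>Agreement on objects places the values of \<open>F\<close> and of
    \<open>G\<close> in the single hom-category \<open>?H\<close>.\<close>
  have F0: "F0 G (So A) = F0 F A" "F0 G (So B) = F0 F B"
    using tr Ob by (auto simp: lax_transformation_def precompose_def)
  obtain s p t where spt: "u = (s, p, t)"
    by (cases u)
  have st: "s \<in> arrow_chains C" "t \<in> arrow_chains C"
      "Dom C (hd s) = A" "Cod C (last s) = B" "Dom C (hd t) = A" "Cod C (last t) = B"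
    using u by (auto simp: spt Arr_chain_semibicat_iff chain_maps_iff)
  \<comment> \<open>\<open>two_op\<close> reverses 2-cells, so \<open>u\<close> runs from
    \<open>t\<close> to \<open>s\<close> here, and the square has \<open>\<sigma> t\<close> on its
    source side and \<open>\<sigma> s\<close> on its target side.\<close>
  have u': "u \<in> hom (hom_cat ?SC A B) t s"
    using u by (simp add: hom_def two_op_def hom_cat_def hom1_def chain_semibicat_def spt)
  have v': "?v \<in> hom (hom_cat ?SD (So A) (So B)) (map Sa t) (map Sa s)"
    using map_chain_map_Arr[OF C \<Sigma> u]
    by (simp add: hom_def two_op_def hom_cat_def hom1_def chain_semibicat_def spt map_chain_map_def)
  have Fu: "F2 F u \<in> hom ?H (F1 F t) (F1 F s)"
    using is_functor.Fa_hom[OF F.functor_hom[OF Ob(1,2)] u'] .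
  have Gv: "F2 G ?v \<in> hom ?H (F1 G (map Sa t)) (F1 G (map Sa s))"
    using is_functor.Fa_hom[OF G.functor_hom[OF Ob(3,4)] v'] by (simp add: F0)
  have nat: "nat_trans (hom_cat ?SC A B) ?H (F1 F) (F2 F)
      (F1 (precompose So Sa G)) (F2 (precompose So Sa G)) \<sigma>"
    using tr Ob by (auto simp: lax_transformation_def)
  have "s \<in> Obj (hom_cat ?SC A B)" "t \<in> Obj (hom_cat ?SC A B)"
    using st by (auto simp: hom_cat_def hom1_def two_op_def chain_semibicat_def)
  then have \<sigma>: "\<sigma> s \<in> hom ?H (F1 F s) (F1 G (map Sa s))" "\<sigma> t \<in> hom ?H (F1 F t) (F1 G (map Sa t))"
    using nat by (auto simp: nat_trans_def precompose_def)
  have sq: "\<sigma> s \<circ>\<^bsub>?H\<^esub> F2 F u = F2 G ?v \<circ>\<^bsub>?H\<^esub> \<sigma> t"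
    using nat u' by (auto simp: nat_trans_def hom_def precompose_def spt map_chain_map_def)
  have "\<sigma> s \<in> W" "\<sigma> t \<in> W"
    using weq st by (auto simp: levelwise_weak_equivalence_def)
  moreover have "two_out_of_three ?H W"
    using W F.F0_Ob Ob by simp
  ultimately show ?thesis
    using two_out_of_three_square[OF _ Fu \<sigma>(1) \<sigma>(2) Gv sq] by simp
qed

theorem proposition4p14:
  fixes M :: "('o, 'm, 't) bicat" and W :: "'t set"
    and C :: "('c, 'a) cat" and D :: "('d, 'b) cat"
    and F :: "('c, 'a, 'o, 'm, 't) chain_lax" and G :: "('d, 'b, 'o, 'm, 't) chain_lax"
    and So :: "'c \<Rightarrow> 'd" and Sa :: "'a \<Rightarrow> 'b" and \<sigma> :: "'a list \<Rightarrow> 't"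
  assumes "base_of_enrichment M W \<or>
           (\<exists>Cof Fib. special_Quillen_algebra M TYPE('i) W Cof Fib)"
    and "category C" and "category D"
    and "S_diagram M C F" and "S_diagram M D G"
    and "S_diagram_morphism M C D F G So Sa \<sigma>"
    and "levelwise_weak_equivalence W C \<sigma>"
  shows "(co_Segal W D G \<longrightarrow> co_Segal W C F) \<and>
         (co_Segal W C F \<and> surjective_on_objects C D So \<and> full_functor C D So Sa \<longrightarrow>
          co_Segal W D G)"
proof -
  have W: "two_out_of_three (hom_cat M U V) W" if UV: "U \<in> Ob M" "V \<in> Ob M" for U V
    using assms(1)
  proof
    assume "base_of_enrichment M W"
    then show ?thesis
      using UV by (rule base_of_enrichment.W_two_out_of_three)
  next
    assume "\<exists>Cof Fib. special_Quillen_algebra M TYPE('i) W Cof Fib"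
    then obtain Cof Fib where "special_Quillen_algebra M TYPE('i) W Cof Fib"
      by auto
    then have "model_category (hom_cat M U V) TYPE('i) (W \<inter> Arr (hom_cat M U V))
        (Cof \<inter> Arr (hom_cat M U V)) (Fib \<inter> Arr (hom_cat M U V))"
      using UV by (rule special_Quillen_algebra.model_hom_cat)
    then show ?thesis
      \<comment> \<open>The model structure gives 2-out-of-3 only for \<open>W\<close> cut down to
        the arrows of this hom-category. Composites stay among those arrows, so the condition is the
        same for \<open>W\<close> itself.\<close>
      using two_out_of_three_Int_Arr model_category.axioms(1) model_category.W_two_out_of_three
      by blast
  qed
  note weq_iff = weak_equivalence_iff[OF W assms(2,4-7)]
  have \<Sigma>: "is_functor C D So Sa"
    using assms(6) by (simp add: S_diagram_morphism_def)
  have "co_Segal W C F" if G: "co_Segal W D G"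
    unfolding co_Segal_def
  proof (intro ballI)
    fix A B u
    assume "A \<in> Obj C" "B \<in> Obj C" "u \<in> Arr (hom_cat (chain_semibicat C) A B)"
    moreover from this have "F2 G (map_chain_map Sa u) \<in> W"
      using G map_chain_map_Arr[OF assms(2) \<Sigma>] is_functor.Fo_Obj[OF \<Sigma>]
      unfolding co_Segal_def by blast
    ultimately show "F2 F u \<in> W"
      using weq_iff by blast
  qed
  moreover have "co_Segal W D G" if F: "co_Segal W C F"
    and lift: "surjective_on_objects C D So" "full_functor C D So Sa"
    unfolding co_Segal_def
  proof (intro ballI)
    fix A B v
    assume "v \<in> Arr (hom_cat (chain_semibicat D) A B)"
    then obtain A' B' u where "A' \<in> Obj C" "B' \<in> Obj C"
        "u \<in> Arr (hom_cat (chain_semibicat C) A' B')" "map_chain_map Sa u = v"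
      by (rule chain_map_lift[OF assms(2,3) \<Sigma> lift])
    then show "F2 G v \<in> W"
      using F weq_iff unfolding co_Segal_def by blast
  qed
  ultimately show ?thesis
    by blast
qed

end
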